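(* Let $m\ge1$. In the preemptive setting, no deterministic online algorithm for makespan minimization on $m$ identical machines with testing is $c$-competitive for any $c<2-\frac2m+\frac1{m^2}$. This holds even when restricted to instances in which all testing times equal $1$.
   Context: Scheduling with testing on $m$ identical parallel machines: there are $n$ jobs; each job $j$ has a testing time $t_j\ge 0$, an upper bound $u_j\ge 0$ and a processing time $p_j$ with $0\le p_j\le u_j$. A job can either be run untested, requiring total processing $u_j$, or be tested (total processing $t_j$) and then executed (total processing $p_j$); the value $p_j$ is revealed to the algorithm only when the test of $j$ is completed. Initially the algorithm knows $m$, $n$ and all $t_j,u_j$, but not the $p_j$. Preemptive setting: a job may be interrupted at any time and continued later on a possibly different machine, but no two machines may work on the same job at the same time; if a job is tested, every part of its test must be processed before any part of its execution. The objective is the makespan. $\mathrm{OPT}$ denotes the optimal makespan of an offline scheduler knowing all $p_j$. A deterministic algorithm is $c$-competitive if its makespan $\mathrm{ALG}$ satisfies $\mathrm{ALG}\le c\cdot\mathrm{OPT}$ on every instance. *)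

theory Defs
  imports "HOL-Analysis.Analysis"
begin

record testing_instance =
  test_time :: "real list"
  upper_bound :: "real list"
  proc_time :: "real list"

definition num_jobs :: "testing_instance \<Rightarrow> nat" where
  "num_jobs I = length (test_time I)"

definition valid_instance :: "testing_instance \<Rightarrow> bool" where
  "valid_instance I \<longleftrightarrow>
     length (upper_bound I) = num_jobs I \<and> length (proc_time I) = num_jobs I \<and>
     (\<forall>j<num_jobs I. 0 \<le> test_time I ! j \<and> 0 \<le> upper_bound I ! j \<and>
        0 \<le> proc_time I ! j \<and> proc_time I ! j \<le> upper_bound I ! j)"

definition all_instances :: "testing_instance set" where
  "all_instances = {I. valid_instance I}"

definition unit_test_instances :: "testing_instance set" where
  "unit_test_instances = {I. valid_instance I \<and> (\<forall>j<num_jobs I. test_time I ! j = 1)}"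

text \<open>\<open>Run j\<close> is the untested run of job \<open>j\<close>; \<open>Exec j\<close> is its execution after a test.\<close>

datatype operation = Test nat | Exec nat | Run nat

fun job_of :: "operation \<Rightarrow> nat" where
  "job_of (Test j) = j"
| "job_of (Exec j) = j"
| "job_of (Run j) = j"

text \<open>\<open>activity S i x\<close> is what machine \<open>i\<close> does at time \<open>x\<close>, with \<open>None\<close> for idling; only machines
  below \<open>m\<close> and times \<open>x \<ge> 0\<close> are relevant. \<open>tests S\<close> lists the tested jobs with the completion
  times of their tests, in the order of completion. It is part of the schedule because a test of
  length 0 leaves no trace in \<open>activity\<close>, and because several such tests may be made one after the
  other, each depending on the outcome of the previous ones, at the same point in time.\<close>

record schedule =
  activity :: "nat \<Rightarrow> real \<Rightarrow> operation option"
  tests :: "(nat \<times> real) list"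

definition tested :: "schedule \<Rightarrow> nat set" where
  "tested S = fst ` set (tests S)"

text \<open>Total amount of processing that an operation has received before time \<open>x\<close>.\<close>

definition work :: "nat \<Rightarrow> schedule \<Rightarrow> operation \<Rightarrow> real \<Rightarrow> real" where
  "work m S a x = (\<Sum>i<m. measure lborel {y. 0 \<le> y \<and> y < x \<and> activity S i y = Some a})"

fun required_work :: "testing_instance \<Rightarrow> schedule \<Rightarrow> operation \<Rightarrow> real" where
  "required_work I S (Test j) =
     (if j < num_jobs I \<and> j \<in> tested S then test_time I ! j else 0)"
| "required_work I S (Exec j) =
     (if j < num_jobs I \<and> j \<in> tested S then proc_time I ! j else 0)"
| "required_work I S (Run j) =
     (if j < num_jobs I \<and> j \<notin> tested S then upper_bound I ! j else 0)"

definition completed_by :: "nat \<Rightarrow> testing_instance \<Rightarrow> schedule \<Rightarrow> real \<Rightarrow> bool" where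
  "completed_by m I S x \<longleftrightarrow> 0 \<le> x \<and>
     (\<forall>a. \<forall>y\<ge>x. work m S a y = required_work I S a) \<and>
     (\<forall>(j, \<tau>) \<in> set (tests S). \<tau> \<le> x)"

text \<open>The last clause of \<open>well_timed_tests\<close> says that \<open>\<tau>\<close> is the first time at which the whole test
  of \<open>j\<close> has been processed; a test of length 0 can be made at any time.\<close>

definition well_timed_tests :: "nat \<Rightarrow> testing_instance \<Rightarrow> schedule \<Rightarrow> bool" where
  "well_timed_tests m I S \<longleftrightarrow>
     distinct (map fst (tests S)) \<and> sorted (map snd (tests S)) \<and>
     (\<forall>(j, \<tau>) \<in> set (tests S). j < num_jobs I \<and> 0 \<le> \<tau> \<and>
        (\<forall>i<m. \<forall>x\<ge>0. activity S i x = Some (Test j) \<longrightarrow> x < \<tau>) \<and>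
        (\<forall>i<m. \<forall>x\<ge>0. activity S i x = Some (Exec j) \<longrightarrow> \<tau> \<le> x) \<and>
        (test_time I ! j > 0 \<longrightarrow> (\<forall>x<\<tau>. work m S (Test j) x < test_time I ! j)))"

definition feasible :: "nat \<Rightarrow> testing_instance \<Rightarrow> schedule \<Rightarrow> bool" where
  "feasible m I S \<longleftrightarrow>
     (\<forall>i<m. \<forall>a. {x. 0 \<le> x \<and> activity S i x = Some a} \<in> sets lborel) \<and>
     (\<forall>i<m. \<forall>x\<ge>0. \<forall>a. activity S i x = Some a \<longrightarrow>
        job_of a < num_jobs I \<and> (a = Run (job_of a) \<longleftrightarrow> job_of a \<notin> tested S)) \<and>
     (\<forall>x\<ge>0. \<forall>i<m. \<forall>i'<m. \<forall>a b. i \<noteq> i' \<and> activity S i x = Some a \<and> activity S i' x = Some b \<longrightarrow>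
        job_of a \<noteq> job_of b) \<and>
     well_timed_tests m I S \<and>
     (\<exists>x. completed_by m I S x)"

definition makespan :: "nat \<Rightarrow> testing_instance \<Rightarrow> schedule \<Rightarrow> real" where
  "makespan m I S = Inf {x. completed_by m I S x}"

definition OPT :: "nat \<Rightarrow> testing_instance \<Rightarrow> real" where
  "OPT m I = Inf {makespan m I S |S. feasible m I S}"

text \<open>\<open>A\<close> is given the complete instance, but may not anticipate: if two instances agree in all
  testing times and upper bounds, and in the processing times revealed by the first \<open>k\<close> completed
  tests, then \<open>A\<close> acts identically on them up to the completion of the next test, which is of the
  same job at the same time (or there is no further test in either case).\<close>

definition nonanticipating ::
  "nat \<Rightarrow> testing_instance set \<Rightarrow> (testing_instance \<Rightarrow> schedule) \<Rightarrow> bool" where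
  "nonanticipating m K A \<longleftrightarrow>
     (\<forall>I\<in>K. \<forall>J\<in>K. \<forall>k.
        test_time I = test_time J \<and> upper_bound I = upper_bound J \<and>
        (\<forall>(j, \<tau>) \<in> set (take k (tests (A I))). proc_time I ! j = proc_time J ! j) \<longrightarrow>
        take (Suc k) (tests (A I)) = take (Suc k) (tests (A J)) \<and>
        (\<forall>i<m. \<forall>x\<ge>0. (k < length (tests (A I)) \<longrightarrow> x < snd (tests (A I) ! k)) \<longrightarrow>
           activity (A I) i x = activity (A J) i x))"

definition online_algorithm ::
  "nat \<Rightarrow> testing_instance set \<Rightarrow> (testing_instance \<Rightarrow> schedule) \<Rightarrow> bool" where
  "online_algorithm m K A \<longleftrightarrow> (\<forall>I\<in>K. feasible m I (A I)) \<and> nonanticipating m K A"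

definition competitive ::
  "nat \<Rightarrow> testing_instance set \<Rightarrow> real \<Rightarrow> (testing_instance \<Rightarrow> schedule) \<Rightarrow> bool" where
  "competitive m K c A \<longleftrightarrow> (\<forall>I\<in>K. makespan m I (A I) \<le> c * OPT m I)"

end

theory Submission
  imports Defs
begin

text \<open>The adversary releases \<open>m (m - 1) + 1\<close> jobs with unit tests and upper bounds so large that no
  job may be run untested. It reveals processing time 0 in every test except the last one to be
  completed, which reveals \<open>m - 1\<close>. All test work precedes this last completion, which
  therefore happens no earlier than \<open>m - 1 + 1 / m\<close>, and the long job still needs \<open>m - 1\<close> more time
  units, since no two machines can share it. The offline scheduler dedicates one machine
  to the long job and puts \<open>m\<close> tests on each of the others, finishing by time \<open>m\<close>.\<close>

section \<open>Lower bounds on the makespan\<close>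

lemma activity_set_before_measurable:
  assumes "feasible m I S" "i < m"
  shows "{y. 0 \<le> y \<and> y < x \<and> activity S i y = Some a} \<in> sets lborel"
proof -
  have "{y. 0 \<le> y \<and> y < x \<and> activity S i y = Some a}
      = {y. 0 \<le> y \<and> activity S i y = Some a} \<inter> {..<x}"
    by auto
  moreover have "{y. 0 \<le> y \<and> activity S i y = Some a} \<in> sets lborel"
    using assms unfolding feasible_def by blast
  ultimately show ?thesis
    by (metis sets.Int sets_lborel lessThan_borel)
qed

text \<open>Used in two ways: for one operation across all machines, and for all tests on one
  machine. The \<open>max 0\<close> covers \<open>r < l\<close>, where the interval is
  empty.\<close>

lemma sum_measure_disjoint_le_interval:
  fixes B :: "'a \<Rightarrow> real set"
  assumes "finite N" "disjoint_family_on B N" "\<And>k. k \<in> N \<Longrightarrow> B k \<in> sets lborel"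
    and sub: "\<And>k. k \<in> N \<Longrightarrow> B k \<subseteq> {l..<r}"
  shows "(\<Sum>k\<in>N. measure lborel (B k)) \<le> max 0 (r - l)"
proof -
  have fin: "{l..<r} \<in> fmeasurable lborel"
    by (rule fmeasurableI2[OF fmeasurable_compact[of "{l..r}"]]) auto
  \<comment> \<open>Finiteness matters because \<open>measure\<close> is 0 on sets of infinite
    measure and is additive only away from them.\<close>
  have "emeasure lborel (B k) \<noteq> \<infinity>" if "k \<in> N" for k
    using fmeasurableI2[OF fin sub[OF that]] assms(3)[OF that]
    by (auto simp: fmeasurable_def)
  then have "(\<Sum>k\<in>N. measure lborel (B k)) = measure lborel (\<Union>k\<in>N. B k)"
    using assms by (intro measure_finite_Union[symmetric]) auto
  also have "\<dots> \<le> measure lborel {l..<r}"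
    using assms fin by (intro measure_mono_fmeasurable) auto
  also have "\<dots> = max 0 (r - l)"
    by (cases "l \<le> r") auto
  finally show ?thesis .
qed

text \<open>No two machines serve the same job simultaneously, so the time sets of one operation on
  the different machines are disjoint: preemption and migration do not speed it up.\<close>

lemma work_le_elapsed:
  assumes "feasible m I S"
    and start: "\<And>i y. i < m \<Longrightarrow> 0 \<le> y \<Longrightarrow> activity S i y = Some a \<Longrightarrow> \<tau> \<le> y"
  shows "work m S a x \<le> max 0 (x - \<tau>)"
  unfolding work_def
proof (rule sum_measure_disjoint_le_interval)
  show "disjoint_family_on (\<lambda>i. {y. 0 \<le> y \<and> y < x \<and> activity S i y = Some a}) {..<m}"
    using assms(1) unfolding feasible_def disjoint_family_on_def by blast
next
  fix i assume i: "i \<in> {..<m}"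
  then show "{y. 0 \<le> y \<and> y < x \<and> activity S i y = Some a} \<in> sets lborel"
    using activity_set_before_measurable[OF assms(1)] by blast
  show "{y. 0 \<le> y \<and> y < x \<and> activity S i y = Some a} \<subseteq> {\<tau>..<x}"
    using start i by auto
qed simp

text \<open>Feasibility makes the set of completion times nonempty, so its \<open>Inf\<close> is a
  genuine infimum.\<close>

lemma makespan_geI:
  assumes "feasible m I S" "\<And>x. completed_by m I S x \<Longrightarrow> b \<le> x"
  shows "b \<le> makespan m I S"
  unfolding makespan_def using assms by (intro cInf_greatest) (auto simp: feasible_def)

lemma makespan_nonneg: "feasible m I S \<Longrightarrow> 0 \<le> makespan m I S"
  by (rule makespan_geI) (auto simp: completed_by_def)

lemma upper_bound_le_makespan:
  assumes "feasible m I S" "j < num_jobs I" "j \<notin> tested S"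
  shows "upper_bound I ! j \<le> makespan m I S"
proof (rule makespan_geI[OF assms(1)])
  fix x assume "completed_by m I S x"
  then have "0 \<le> x" "work m S (Run j) x = upper_bound I ! j"
    using assms by (auto simp: completed_by_def)
  then show "upper_bound I ! j \<le> x"
    using work_le_elapsed[OF assms(1), of "Run j" 0 x] by auto
qed

text \<open>The execution starts only after the test is completed and then progresses at unit speed
  at most.\<close>

lemma test_completion_plus_proc_le_makespan:
  assumes "feasible m I S" "(j, \<tau>) \<in> set (tests S)"
  shows "\<tau> + proc_time I ! j \<le> makespan m I S"
proof (rule makespan_geI[OF assms(1)])
  fix x assume c: "completed_by m I S x"
  have j: "j < num_jobs I" and exec: "\<And>i y. i < m \<Longrightarrow> 0 \<le> y \<Longrightarrow> activity S i y = Some (Exec j) \<Longrightarrow> \<tau> \<le> y"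
    using assms unfolding feasible_def well_timed_tests_def by fast+
  have "j \<in> tested S"
    using assms(2) by (force simp: tested_def)
  then have "work m S (Exec j) x = proc_time I ! j" "\<tau> \<le> x"
    using c j assms(2) by (auto simp: completed_by_def)
  then show "\<tau> + proc_time I ! j \<le> x"
    using work_le_elapsed[OF assms(1), of "Exec j" \<tau> x] exec by auto
qed

text \<open>Before \<tau> the machines offer capacity \<open>m * \<tau>\<close>, and all test work
  has to fit there. The double sum is counted machine by machine, where different tests occupy
  disjoint times.\<close>

lemma total_test_time_le_last_completion:
  assumes "feasible m I S" "0 \<le> \<tau>" and last: "\<And>j \<tau>'. (j, \<tau>') \<in> set (tests S) \<Longrightarrow> \<tau>' \<le> \<tau>"
  shows "(\<Sum>j\<in>tested S. test_time I ! j) \<le> real m * \<tau>"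
proof -
  obtain x where c: "completed_by m I S x"
    using assms(1) by (auto simp: feasible_def)
  let ?B = "\<lambda>i j. {y. 0 \<le> y \<and> y < x \<and> activity S i y = Some (Test j)}"
  have fin: "finite (tested S)"
    by (simp add: tested_def)
  have "test_time I ! j = work m S (Test j) x" if "j \<in> tested S" for j
  proof -
    have "j < num_jobs I"
      using assms(1) that unfolding feasible_def well_timed_tests_def tested_def by fastforce
    then show ?thesis
      using c that by (auto simp: completed_by_def)
  qed
  then have "(\<Sum>j\<in>tested S. test_time I ! j) = (\<Sum>j\<in>tested S. \<Sum>i<m. measure lborel (?B i j))"
    by (simp add: work_def)
  also have "\<dots> = (\<Sum>i<m. \<Sum>j\<in>tested S. measure lborel (?B i j))"
    by (rule sum.swap)
  also have "\<dots> \<le> (\<Sum>i<m. max 0 (\<tau> - 0))"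
  proof (intro sum_mono sum_measure_disjoint_le_interval fin)
    fix i j assume i: "i \<in> {..<m}" and "j \<in> tested S"
    then obtain \<tau>' where t: "(j, \<tau>') \<in> set (tests S)"
      by (auto simp: tested_def)
    then have "\<And>y. 0 \<le> y \<Longrightarrow> activity S i y = Some (Test j) \<Longrightarrow> y < \<tau>'"
      using assms(1) i unfolding feasible_def well_timed_tests_def by fast
    then show "?B i j \<subseteq> {0..<\<tau>}"
      using last[OF t] by force
    show "?B i j \<in> sets lborel"
      using activity_set_before_measurable[OF assms(1)] i by blast
  next
    show "disjoint_family_on (?B i) (tested S)" for i
      by (auto simp: disjoint_family_on_def)
  qed
  finally show ?thesis
    using assms(2) by simp
qed

lemma OPT_nonneg:
  assumes "feasible m I S"
  shows "0 \<le> OPT m I"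
  unfolding OPT_def using assms makespan_nonneg by (intro cInf_greatest) auto

lemma OPT_le:
  assumes "feasible m I S" "completed_by m I S x"
  shows "OPT m I \<le> x"
proof -
  have "OPT m I \<le> makespan m I S"
    unfolding OPT_def using assms makespan_nonneg
    by (intro cInf_lower bdd_belowI[of _ 0]) auto
  also have "\<dots> \<le> x"
    unfolding makespan_def using assms
    by (intro cInf_lower bdd_belowI[of _ 0]) (auto simp: completed_by_def)
  finally show ?thesis .
qed

section \<open>The adversarial instances and their offline schedule\<close>

text \<open>The largest index, counting jobs from 0. It says nothing about the order of
  testing.\<close>

definition last_job :: "nat \<Rightarrow> nat" where
  "last_job m = m * (m - 1)"

text \<open>Job \<open>j\<close> has processing time \<open>q\<close>; with \<open>q = 0\<close> the
  choice of \<open>j\<close> is immaterial. The upper bound \<open>4 * real m\<close> exceeds every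
  makespan allowed to the algorithm, which is below \<open>2 * real m\<close>.\<close>

definition adversary_instance :: "nat \<Rightarrow> nat \<Rightarrow> real \<Rightarrow> testing_instance" where
  "adversary_instance m j q =
    \<lparr>test_time = replicate (Suc (last_job m)) 1,
     upper_bound = replicate (Suc (last_job m)) (4 * real m),
     proc_time = map (\<lambda>k. if k = j then q else 0) [0..<Suc (last_job m)]\<rparr>"

lemma num_jobs_adversary_instance [simp]:
  "num_jobs (adversary_instance m j q) = Suc (last_job m)"
  by (simp add: adversary_instance_def num_jobs_def)

lemma adversary_instance_nth [simp]:
  assumes "k \<le> last_job m"
  shows "test_time (adversary_instance m j q) ! k = 1"
    "upper_bound (adversary_instance m j q) ! k = 4 * real m"
    "proc_time (adversary_instance m j q) ! k = (if k = j then q else 0)"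
  using assms by (auto simp: adversary_instance_def simp del: replicate_Suc upt_Suc)

lemma adversary_instance_initially_indistinguishable:
  "test_time (adversary_instance m j q) = test_time (adversary_instance m j' q')"
  "upper_bound (adversary_instance m j q) = upper_bound (adversary_instance m j' q')"
  by (simp_all add: adversary_instance_def)

lemma adversary_instance_unit_test:
  assumes "0 \<le> q" "q \<le> real m"
  shows "adversary_instance m j q \<in> unit_test_instances"
proof -
  have "length (upper_bound (adversary_instance m j q)) = Suc (last_job m)"
    "length (proc_time (adversary_instance m j q)) = Suc (last_job m)"
    by (simp_all add: adversary_instance_def)
  then show ?thesis
    using assms by (auto simp: unit_test_instances_def valid_instance_def less_Suc_eq_le)
qed

text \<open>Position \<open>k\<close> stands for the unit time slot \<open>k mod m\<close> on machine \<open>k div m\<close>. The last position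
  \<open>last_job m\<close> is the first slot of the last machine; the transposition gives it to the long job
  \<open>j\<close>.\<close>

definition offline_schedule :: "nat \<Rightarrow> nat \<Rightarrow> real \<Rightarrow> schedule" where
  "offline_schedule m j q =
    \<lparr>activity = (\<lambda>i x.
       if 0 \<le> x \<and> x < real m \<and> m * i + nat \<lfloor>x\<rfloor> \<le> last_job m
       then Some (Test (Transposition.transpose j (last_job m) (m * i + nat \<lfloor>x\<rfloor>)))
       else if i = m - 1 \<and> 1 \<le> x \<and> x < 1 + q then Some (Exec j) else None),
     tests = sort_key snd
       (map (\<lambda>a. (a, real (Transposition.transpose j (last_job m) a mod m) + 1)) [0..<Suc (last_job m)])\<rparr>"

lemma set_tests_offline_schedule:
  "set (tests (offline_schedule m j q)) =
    (\<lambda>a. (a, real (Transposition.transpose j (last_job m) a mod m) + 1)) ` {..last_job m}"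
  by (auto simp: offline_schedule_def image_iff)

lemma tested_offline_schedule: "tested (offline_schedule m j q) = {..last_job m}"
  unfolding tested_def set_tests_offline_schedule by (simp add: image_image)

context
  fixes m j :: nat and q :: real
  assumes m: "1 \<le> m" and j: "j \<le> last_job m" and q: "0 \<le> q" "q \<le> real m - 1"
begin

abbreviation "position a \<equiv> Transposition.transpose j (last_job m) a"

text \<open>Both swapped elements lie in \<open>{..last_job m}\<close>, so the transposition
  permutes this set.\<close>

lemma position_le_iff: "position a \<le> last_job m \<longleftrightarrow> a \<le> last_job m"
  using j by (auto simp: Transposition.transpose_def)

lemma position_div_less:
  assumes "a \<le> last_job m"
  shows "position a div m < m"
proof -
  have "position a \<le> last_job m"
    using assms by (simp add: position_le_iff)
  also have "\<dots> < m * m"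
    using m by (simp add: last_job_def)
  finally show ?thesis
    by (simp add: less_mult_imp_div_less)
qed

text \<open>A transposition is its own inverse, so the test of \<open>a\<close> sits at
  \<open>position a\<close>, whose quotient and remainder by \<open>m\<close> recover machine and
  slot.\<close>

lemma activity_offline_Test:
  assumes "0 \<le> x"
  shows "activity (offline_schedule m j q) i x = Some (Test a) \<longleftrightarrow>
    a \<le> last_job m \<and> i = position a div m \<and>
    real (position a mod m) \<le> x \<and> x < real (position a mod m) + 1"
    (is "?L \<longleftrightarrow> ?R")
proof
  assume L: ?L
  then have x: "x < real m" and le: "m * i + nat \<lfloor>x\<rfloor> \<le> last_job m"
    and a: "a = position (m * i + nat \<lfloor>x\<rfloor>)"
    by (auto simp: offline_schedule_def split: if_splits)
  from a have pos: "position a = m * i + nat \<lfloor>x\<rfloor>"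
    by simp
  have "nat \<lfloor>x\<rfloor> < m"
    using x assms by linarith
  then have "position a div m = i" "position a mod m = nat \<lfloor>x\<rfloor>"
    unfolding pos by simp_all
  moreover have "a \<le> last_job m"
    using le pos position_le_iff[of a] by simp
  ultimately show ?R
    using assms by (auto simp: floor_correct)
next
  assume R: ?R
  then have s: "nat \<lfloor>x\<rfloor> = position a mod m"
    by linarith
  have "position a mod m < m"
    using m by simp
  then have "real (position a mod m) + 1 \<le> real m"
    by linarith
  then have "x < real m"
    using R by linarith
  moreover have "m * i + nat \<lfloor>x\<rfloor> = position a"
    using R s by simp
  ultimately show ?L
    using R assms position_le_iff[of a] by (simp add: offline_schedule_def)
qed

lemma activity_offline_Exec:
  assumes "0 \<le> x"
  shows "activity (offline_schedule m j q) i x = Some (Exec a) \<longleftrightarrow>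
    a = j \<and> i = m - 1 \<and> 1 \<le> x \<and> x < 1 + q"
proof -
  \<comment> \<open>The test branch of the schedule does not shadow the execution: after its first
    slot, the last machine has no test positions left.\<close>
  have "\<not> m * (m - 1) + nat \<lfloor>x\<rfloor> \<le> last_job m" if "1 \<le> x"
    using that by (simp add: last_job_def le_floor_iff)
  then show ?thesis
    by (auto simp: offline_schedule_def)
qed

lemma activity_offline_Run: "activity (offline_schedule m j q) i x \<noteq> Some (Run a)"
  by (simp add: offline_schedule_def)

text \<open>Stated for every \<open>x\<close>, since a well-timed test must also be incomplete at
  each time before its slot ends.\<close>

lemma work_offline_Test:
  "work m (offline_schedule m j q) (Test a) x =
    (if a \<le> last_job m
     then max 0 (min x (real (position a mod m) + 1) - real (position a mod m)) else 0)"
proof -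
  let ?s = "real (position a mod m)"
  have "{y. 0 \<le> y \<and> y < x \<and> activity (offline_schedule m j q) i y = Some (Test a)} =
      (if a \<le> last_job m \<and> i = position a div m then {?s..<min x (?s + 1)} else {})" for i
    by (auto simp: activity_offline_Test cong: conj_cong)
  then have "work m (offline_schedule m j q) (Test a) x =
      (\<Sum>i<m. if i = position a div m then
         (if a \<le> last_job m then measure lborel {?s..<min x (?s + 1)} else 0) else 0)"
    unfolding work_def by (intro sum.cong) auto
  also have "\<dots> = (if a \<le> last_job m then measure lborel {?s..<min x (?s + 1)} else 0)"
    using position_div_less[of a] by simp
  also have "measure lborel {?s..<min x (?s + 1)} = max 0 (min x (?s + 1) - ?s)"
    by (cases "?s \<le> min x (?s + 1)") (auto simp del: min_less_iff_conj)
  finally show ?thesis .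
qed

lemma work_offline_Exec:
  assumes "real m \<le> x"
  shows "work m (offline_schedule m j q) (Exec a) x = (if a = j then q else 0)"
proof -
  have "{y. 0 \<le> y \<and> y < x \<and> activity (offline_schedule m j q) i y = Some (Exec a)} =
      (if a = j \<and> i = m - 1 then {1..<1 + q} else {})" for i
    using assms q by (auto simp: activity_offline_Exec cong: conj_cong)
  then have "work m (offline_schedule m j q) (Exec a) x =
      (\<Sum>i<m. if i = m - 1 then (if a = j then q else 0) else 0)"
    unfolding work_def using q by (intro sum.cong) auto
  then show ?thesis
    using m by simp
qed

text \<open>Every test slot ends by time \<open>m\<close>, and the execution of \<open>j\<close>
  ends at \<open>1 + q\<close>, which is at most \<open>m\<close> by the bound on
  \<open>q\<close>.\<close>

lemma offline_schedule_completed: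
  "completed_by m (adversary_instance m j q) (offline_schedule m j q) (real m)"
proof -
  have slot: "real (position a mod m) + 1 \<le> real m" for a
  proof -
    have "position a mod m < m"
      using m by simp
    then show ?thesis
      by linarith
  qed
  have "work m (offline_schedule m j q) b y =
      required_work (adversary_instance m j q) (offline_schedule m j q) b"
    if y: "real m \<le> y" for b y
  proof (cases b)
    case (Test a)
    then show ?thesis
      using slot[of a] y
      by (auto simp: work_offline_Test tested_offline_schedule less_Suc_eq_le)
  next
    case (Exec a)
    then show ?thesis
      using y j
      by (auto simp: work_offline_Exec tested_offline_schedule less_Suc_eq_le)
  next
    case (Run a)
    then show ?thesis
      by (auto simp: work_def activity_offline_Run tested_offline_schedule)
  qed
  then show ?thesis
    using slot unfolding completed_by_def set_tests_offline_schedule by auto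
qed

lemma offline_schedule_well_timed:
  "well_timed_tests m (adversary_instance m j q) (offline_schedule m j q)"
proof -
  let ?S = "offline_schedule m j q"
  have "distinct (map fst (tests ?S))"
    by (auto simp: offline_schedule_def distinct_map inj_on_def simp del: upt_Suc)
  moreover have "sorted (map snd (tests ?S))"
    by (simp add: offline_schedule_def)
  \<comment> \<open>Here \<open>a = j\<close>, and \<open>position j = last_job m\<close> is a
    multiple of \<open>m\<close>; hence the test of \<open>j\<close> ends at time 1, exactly when
    its execution may start.\<close>
  moreover have "real (position a mod m) + 1 \<le> x"
    if "activity ?S i x = Some (Exec a)" "0 \<le> x" for a i x
    using that by (auto simp: activity_offline_Exec last_job_def)
  moreover have "work m ?S (Test a) x < 1" if "x < real (position a mod m) + 1" for a x
    using that by (simp add: work_offline_Test)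
  ultimately show ?thesis
    unfolding well_timed_tests_def set_tests_offline_schedule
    by (auto simp: activity_offline_Test less_Suc_eq_le)
qed

lemma offline_schedule_feasible:
  "feasible m (adversary_instance m j q) (offline_schedule m j q)"
proof -
  let ?S = "offline_schedule m j q"
  have "{x. 0 \<le> x \<and> activity ?S i x = Some b} \<in> sets lborel" for i b
  proof (cases b)
    case (Test a)
    then have "{x. 0 \<le> x \<and> activity ?S i x = Some b} =
        (if a \<le> last_job m \<and> i = position a div m
         then {real (position a mod m)..<real (position a mod m) + 1} else {})"
      by (auto simp: activity_offline_Test cong: conj_cong)
    then show ?thesis by simp
  next
    case (Exec a)
    then have "{x. 0 \<le> x \<and> activity ?S i x = Some b} =
        (if a = j \<and> i = m - 1 then {1..<1 + q} else {})"
      by (auto simp: activity_offline_Exec cong: conj_cong)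
    then show ?thesis by simp
  qed (simp add: activity_offline_Run)
  moreover have "job_of b \<le> last_job m \<and> b \<noteq> Run (job_of b)"
    if "0 \<le> x" "activity ?S i x = Some b" for i x b
    using that j by (cases b) (auto simp: activity_offline_Test activity_offline_Exec activity_offline_Run)
  moreover have "job_of b \<noteq> job_of b'"
    if "0 \<le> x" "i \<noteq> i'" "activity ?S i x = Some b" "activity ?S i' x = Some b'" for x i i' b b'
  proof -
    \<comment> \<open>The test and the execution of \<open>j\<close> share machine
      \<open>m - 1\<close>, so they never run on two different machines.\<close>
    have "last_job m div m = m - 1"
      using m by (simp add: last_job_def)
    then show ?thesis
      using that m
      by (cases b; cases b')
        (auto simp: activity_offline_Test activity_offline_Exec activity_offline_Run)
  qed
  ultimately show ?thesis
    unfolding feasible_def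
    using offline_schedule_well_timed offline_schedule_completed
    by (auto simp: tested_offline_schedule less_Suc_eq_le)
qed

lemma OPT_adversary_instance:
  "0 \<le> OPT m (adversary_instance m j q)" "OPT m (adversary_instance m j q) \<le> real m"
  using OPT_nonneg OPT_le offline_schedule_feasible offline_schedule_completed by blast+

end

section \<open>The adversary argument\<close>

text \<open>Later rules out further tests once all jobs are known to have been tested.\<close>

lemma tests_length_le_num_jobs:
  assumes "feasible m I S"
  shows "length (tests S) \<le> num_jobs I"
proof -
  have d: "distinct (map fst (tests S))" and "set (map fst (tests S)) \<subseteq> {..<num_jobs I}"
    using assms unfolding feasible_def well_timed_tests_def by auto
  then have "card (set (map fst (tests S))) \<le> num_jobs I"
    using card_mono[of "{..<num_jobs I}"] by simp
  then show ?thesis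
    using distinct_card[OF d] by simp
qed

text \<open>Any class \<open>K\<close> containing the unit-test instances is allowed, so that both
  claims of the theorem are special cases.\<close>

lemma not_competitive:
  fixes c :: real
  assumes m: "1 \<le> m" and c: "c < 2 - 2 / real m + 1 / (real m)\<^sup>2"
    and K: "unit_test_instances \<subseteq> K" and online: "online_algorithm m K A"
  shows "\<not> competitive m K c A"
proof
  assume comp: "competitive m K c A"
  define n where "n = Suc (last_job m)"
  have real_n: "real n = real m * (real m - 1) + 1"
    using m by (simp add: n_def last_job_def of_nat_diff)
  have inK: "adversary_instance m j q \<in> K" if "0 \<le> q" "q \<le> real m - 1" for j q
    using K adversary_instance_unit_test[of q m] that by force
  have feas: "feasible m (adversary_instance m j q) (A (adversary_instance m j q))"
    if "0 \<le> q" "q \<le> real m - 1" for j q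
    using online inK[OF that] by (simp add: online_algorithm_def)
  \<comment> \<open>Passing to \<open>max 0 c\<close> keeps multiplication monotone, as
    \<open>c\<close> may be negative.\<close>
  have ALG: "makespan m (adversary_instance m j q) (A (adversary_instance m j q)) \<le> max 0 c * real m"
    if "j < n" "0 \<le> q" "q \<le> real m - 1" for j q
  proof -
    have "makespan m (adversary_instance m j q) (A (adversary_instance m j q))
        \<le> c * OPT m (adversary_instance m j q)"
      using comp inK[OF that(2,3)] by (simp add: competitive_def)
    also have "\<dots> \<le> max 0 c * OPT m (adversary_instance m j q)"
      using OPT_adversary_instance[of m j q] that m by (intro mult_right_mono) (auto simp: n_def)
    also have "\<dots> \<le> max 0 c * real m"
      using OPT_adversary_instance[of m j q] that m by (intro mult_left_mono) (auto simp: n_def)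
    finally show ?thesis .
  qed
  \<comment> \<open>The two summands are the earliest possible last test completion and the length
    of the long job.\<close>
  have bound: "(2 - 2 / real m + 1 / (real m)\<^sup>2) * real m = real n / real m + (real m - 1)"
    using m by (simp add: real_n field_simps power2_eq_square)
  have n_pos: "real n / real m + (real m - 1) > 0"
    using m by (intro add_pos_nonneg) (auto simp: n_def)
  have small: "max 0 c * real m < real n / real m + (real m - 1)"
    using m n_pos mult_strict_right_mono[OF c, of "real m"] unfolding bound
    by (auto simp: max_def)
  have "real n \<le> real m * real m"
    using m by (simp add: real_n algebra_simps)
  then have "real n / real m \<le> real m"
    using m by (simp add: field_simps)
  with small m have less_upper: "max 0 c * real m < 4 * real m"
    by linarith

  \<comment> \<open>The run on the all-zero instance determines which job \<open>j\<close> is tested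
    last, and so which job the adversary makes long.\<close>
  define I where "I = adversary_instance m 0 0"
  have feasI: "feasible m I (A I)"
    unfolding I_def using feas m by simp
  \<comment> \<open>An untested job alone would force makespan \<open>4 * real m\<close>.\<close>
  have "j \<in> tested (A I)" if "j < n" for j
  proof (rule ccontr)
    assume "j \<notin> tested (A I)"
    then have "4 * real m \<le> makespan m I (A I)"
      using upper_bound_le_makespan[OF feasI, of j] that
      by (simp add: I_def n_def)
    moreover have "makespan m I (A I) \<le> max 0 c * real m"
      unfolding I_def using ALG[of 0 0] m by (simp add: n_def)
    ultimately show False
      using less_upper by linarith
  qed
  moreover have "tested (A I) \<subseteq> {..<n}"
    using feasI unfolding feasible_def well_timed_tests_def tested_def
    by (fastforce simp: I_def n_def)
  ultimately have testedI: "tested (A I) = {..<n}"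
    by auto
  have dist: "distinct (map fst (tests (A I)))" and sort: "sorted (map snd (tests (A I)))"
    using feasI by (auto simp: feasible_def well_timed_tests_def)
  have lenI: "length (tests (A I)) = n"
    using distinct_card[OF dist] testedI by (simp add: tested_def)
  then obtain ts j \<tau> where ts: "tests (A I) = ts @ [(j, \<tau>)]"
    by (cases "tests (A I)" rule: rev_cases) (auto simp: n_def)
  have jn: "j < n"
    using testedI ts by (force simp: tested_def)

  define J where "J = adversary_instance m j (real m - 1)"
  have feasJ: "feasible m J (A J)"
    unfolding J_def using feas m by simp
  \<comment> \<open>\<open>I\<close> and \<open>J\<close> differ only in job \<open>j\<close>, and
    distinctness keeps \<open>j\<close> out of \<open>ts\<close>: all outcomes before the last test
    coincide.\<close>
  have "proc_time I ! k = proc_time J ! k" if "(k, \<sigma>) \<in> set ts" for k \<sigma>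
  proof -
    have "k \<noteq> j"
      using dist that unfolding ts by force
    moreover have "k < n"
      using testedI that ts by (force simp: tested_def)
    ultimately show ?thesis
      by (simp add: I_def J_def n_def)
  qed
  moreover have "I \<in> K" "J \<in> K"
    using inK m by (simp_all add: I_def J_def)
  moreover have "test_time I = test_time J" "upper_bound I = upper_bound J"
    unfolding I_def J_def by (rule adversary_instance_initially_indistinguishable)+
  \<comment> \<open>Nonanticipation with \<open>k = length ts\<close> also fixes the next test, so
    \<open>j\<close> completes its test at the same \<tau> in both runs although the outcome
    differs.\<close>
  ultimately have "take (Suc (length ts)) (tests (A I)) = take (Suc (length ts)) (tests (A J))"
    using online unfolding online_algorithm_def nonanticipating_def ts
    by (elim conjE ballE[of _ _ I] ballE[of _ _ J] allE[of _ "length ts"]) (auto simp: ts)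
  then have testsJ: "tests (A J) = ts @ [(j, \<tau>)]"
    using lenI tests_length_le_num_jobs[OF feasJ] by (simp add: ts J_def n_def)
  have last: "\<sigma> \<le> \<tau>" if "(k, \<sigma>) \<in> set (tests (A J))" for k \<sigma>
    using sort that unfolding testsJ ts by (auto simp: sorted_append)
  have "0 \<le> \<tau>"
    using feasJ unfolding feasible_def well_timed_tests_def testsJ by auto
  have "tested (A J) = {..<n}"
    using testedI by (simp add: tested_def ts testsJ)
  \<comment> \<open>The \<open>n\<close> unit tests all finish by \<tau>, which is the last
    completion in the run on \<open>J\<close> as well.\<close>
  then have "real n \<le> real m * \<tau>"
    using total_test_time_le_last_completion[OF feasJ \<open>0 \<le> \<tau>\<close> last]
    by (simp add: J_def n_def)
  then have "real n / real m \<le> \<tau>"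
    using m by (simp add: field_simps)
  moreover have "\<tau> + (real m - 1) \<le> makespan m J (A J)"
    using test_completion_plus_proc_le_makespan[OF feasJ, of j \<tau>] jn testsJ
    by (simp add: J_def n_def)
  moreover have "makespan m J (A J) \<le> max 0 c * real m"
    unfolding J_def using ALG[OF jn, of "real m - 1"] m by simp
  ultimately show False
    using small by linarith
qed

theorem theorem6:
  fixes m :: nat and c :: real
  assumes "m \<ge> 1" and "c < 2 - 2 / real m + 1 / (real m)\<^sup>2"
  shows "\<not> (\<exists>A. online_algorithm m all_instances A \<and> competitive m all_instances c A) \<and>
    \<not> (\<exists>A. online_algorithm m unit_test_instances A \<and> competitive m unit_test_instances c A)"
proof -
  have "unit_test_instances \<subseteq> all_instances"
    by (auto simp: unit_test_instances_def all_instances_def)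
  then show ?thesis
    using not_competitive[OF assms] by blast
qed

end
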